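(* Let $p$ be a prime, $\mathbf{F}$ a field of characteristic $p$ and $d\in\mathbb{N}$. Let $$M=\{\operatorname{LM}(f)\mid 0\ne f\in \mathbf{F}[d\,V_2]_{(1,1,\dots,1)}^{C_p}\}$$ be the set of lead monomials of multi-linear invariants. Then $\Lambda$ restricts to a bijection $$\Lambda:\ \mathrm{PDP}^d_{\le p-2}\sqcup\mathrm{IDP}^d_{p-1}\longrightarrow M.$$
   Context: $\mathbf{F}[d\,V_2]=\mathbf{F}[x_1,y_1,\dots,x_d,y_d]$, and $C_p=\langle\sigma\rangle$ (cyclic of order $p$) acts by algebra automorphisms with $\sigma(x_i)=x_i$, $\sigma(y_i)=y_i+x_i$. The ring is graded by multi-degree in $\mathbb{N}^d$ ($x_i,y_i$ have multi-degree the $i$-th unit vector); $\mathbf{F}[d\,V_2]_{(1,\dots,1)}\cong\otimes^dV_2$ is the component of multi-linear polynomials. Term order: graded reverse lexicographic with $y_1>x_1>y_2>x_2>\dots>y_d>x_d$; $\operatorname{LM}$ is the lead monomial (no coefficient). A lattice path of length $d$ is a sequence of $d$ steps starting at the origin, each $(1,0)$ (an $x$-step) or $(0,1)$ (a $y$-step); it is encoded by its word $\gamma_1\cdots\gamma_d$ in the letters $x,y$. Its height is the largest integer $h$ such that the path touches the line $y=x-h$; its finishing height is $h$ if it ends on the line $y=x-h$. A partial Dyck path is a lattice path staying on or below the line $y=x$. An initial Dyck path of escape height $t$ is a lattice path consisting of a partial Dyck path of finishing height $t$ followed by an arbitrary sequence of steps. $\mathrm{PDP}^d_{\le q}$ is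 the set of partial Dyck paths of length $d$ and height at most $q$; $\mathrm{IDP}^d_q$ is the set of initial Dyck paths of length $d$ and escape height $q$. For a lattice path $\gamma$ of length $d$, $\Lambda(\gamma)=z_1\cdots z_d$ where $z_i=x_i$ if $\gamma_i=x$ and $z_i=y_i$ if $\gamma_i=y$. *)

theory Defs
  imports "HOL-Library.Poly_Mapping" "HOL-Computational_Algebra.Primes"
begin

section \<open>The ring \<open>F[d V\<^sub>2]\<close>\<close>

datatype var = X nat | Y nat

fun idx :: "var \<Rightarrow> nat" where
  "idx (X i) = i"
| "idx (Y i) = i"

text \<open>Monomials are exponent vectors; a polynomial maps monomials to coefficients. Multiplication on
  \<open>mpoly\<close> is the convolution product provided by \<^theory>\<open>HOL-Library.Poly_Mapping\<close>.\<close>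

type_synonym monom = "var \<Rightarrow>\<^sub>0 nat"
type_synonym 'a mpoly = "monom \<Rightarrow>\<^sub>0 'a"

definition const :: "'a::zero \<Rightarrow> 'a mpoly" where
  "const c = Poly_Mapping.single 0 c"

definition var_poly :: "var \<Rightarrow> 'a::zero_neq_one mpoly" where
  "var_poly v = Poly_Mapping.single (Poly_Mapping.single v 1) 1"

definition poly_ring :: "nat \<Rightarrow> 'a::field mpoly set" where
  "poly_ring d = {f. \<forall>m \<in> Poly_Mapping.keys f. \<forall>v \<in> Poly_Mapping.keys m. idx v \<in> {1..d}}"

definition multidegree :: "monom \<Rightarrow> nat \<Rightarrow> nat" where
  "multidegree m i = Poly_Mapping.lookup m (X i) + Poly_Mapping.lookup m (Y i)"

definition homogeneous_component :: "nat \<Rightarrow> (nat \<Rightarrow> nat) \<Rightarrow> 'a::field mpoly set" where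
  "homogeneous_component d e =
     {f \<in> poly_ring d. \<forall>m \<in> Poly_Mapping.keys f. \<forall>i \<in> {1..d}. multidegree m i = e i}"


section \<open>The action of \<open>C\<^sub>p\<close>\<close>

fun sigma_var :: "var \<Rightarrow> 'a::field mpoly" where
  "sigma_var (X i) = var_poly (X i)"
| "sigma_var (Y i) = var_poly (Y i) + var_poly (X i)"

definition sigma_monom :: "monom \<Rightarrow> 'a::field mpoly" where
  "sigma_monom m = (\<Prod>v \<in> Poly_Mapping.keys m. sigma_var v ^ Poly_Mapping.lookup m v)"

definition sigma :: "'a::field mpoly \<Rightarrow> 'a mpoly" where
  "sigma f = (\<Sum>m \<in> Poly_Mapping.keys f. const (Poly_Mapping.lookup f m) * sigma_monom m)"

text \<open>The following lemmas confirm that \<open>sigma\<close> is the algebra endomorphism extending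
  \<open>sigma_var\<close>.\<close>

lemma sigma_monom_superset:
  assumes "finite S" "Poly_Mapping.keys m \<subseteq> S"
  shows "sigma_monom m = (\<Prod>v \<in> S. sigma_var v ^ Poly_Mapping.lookup m v)"
  unfolding sigma_monom_def
  by (rule prod.mono_neutral_left) (use assms in \<open>auto simp: in_keys_iff\<close>)

lemma sigma_monom_zero [simp]: "sigma_monom 0 = 1"
  by (simp add: sigma_monom_def)

lemma sigma_monom_add: "sigma_monom (m + n) = sigma_monom m * sigma_monom n"
proof -
  let ?S = "Poly_Mapping.keys m \<union> Poly_Mapping.keys n"
  have "Poly_Mapping.keys (m + n) \<subseteq> ?S"
    by (rule keys_add)
  then show ?thesis
    by (simp add: sigma_monom_superset[of ?S] lookup_add power_add prod.distrib)
qed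

lemma sigma_single: "sigma (Poly_Mapping.single m c) = const c * sigma_monom m"
  by (cases "c = 0") (auto simp: sigma_def const_def)

lemma sigma_const [simp]: "sigma (const c) = const c"
  using sigma_single[of 0 c] by (simp add: const_def)

lemma sigma_var_poly [simp]: "sigma (var_poly v) = sigma_var v"
  by (simp add: var_poly_def sigma_single sigma_monom_def const_def)

lemma sigma_add: "sigma (f + g) = sigma f + sigma g"
  unfolding sigma_def
  by (rule setsum_keys_plus_distrib) (simp_all add: const_def single_add distrib_right)

lemma sigma_zero [simp]: "sigma 0 = 0"
  by (simp add: sigma_def)

lemma sigma_sum: "sigma (\<Sum>i \<in> A. f i) = (\<Sum>i \<in> A. sigma (f i))"
  by (induction A rule: infinite_finite_induct) (simp_all add: sigma_add)

lemma mpoly_eq_sum_singles: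
  "f = (\<Sum>m \<in> Poly_Mapping.keys f. Poly_Mapping.single m (Poly_Mapping.lookup f m))"
  by (rule poly_mapping_eqI) (auto simp: lookup_sum lookup_single when_def in_keys_iff)

lemma sigma_mult: "sigma (f * g) = sigma f * sigma g"
proof -
  let ?s = "\<lambda>h m. Poly_Mapping.single m (Poly_Mapping.lookup h m)"
  have *: "sigma (Poly_Mapping.single m a * Poly_Mapping.single n b) =
        sigma (Poly_Mapping.single m a) * sigma (Poly_Mapping.single n b)" for m n and a b :: 'a
  proof -
    have "const (a * b) = const a * const b"
      by (simp add: const_def mult_single)
    then show ?thesis
      by (simp only: mult_single sigma_single sigma_monom_add ac_simps)
  qed
  have "f * g = (\<Sum>m \<in> Poly_Mapping.keys f. ?s f m) * (\<Sum>n \<in> Poly_Mapping.keys g. ?s g n)"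
    by (simp only: mpoly_eq_sum_singles[symmetric])
  also have "\<dots> = (\<Sum>m \<in> Poly_Mapping.keys f. \<Sum>n \<in> Poly_Mapping.keys g. ?s f m * ?s g n)"
    by (rule sum_product)
  finally have "sigma (f * g) =
      (\<Sum>m \<in> Poly_Mapping.keys f. \<Sum>n \<in> Poly_Mapping.keys g. sigma (?s f m) * sigma (?s g n))"
    by (simp only: sigma_sum *)
  also have "\<dots> = sigma (\<Sum>m \<in> Poly_Mapping.keys f. ?s f m) *
      sigma (\<Sum>n \<in> Poly_Mapping.keys g. ?s g n)"
    by (simp only: sigma_sum sum_product)
  also have "\<dots> = sigma f * sigma g"
    by (simp only: mpoly_eq_sum_singles[symmetric])
  finally show ?thesis .
qed

text \<open>\<open>C\<^sub>p\<close> acts through the powers of \<open>sigma\<close>.\<close>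

definition invariants :: "'a::field mpoly set" where
  "invariants = {f. \<forall>k. (sigma ^^ k) f = f}"

definition multilinear_invariants :: "nat \<Rightarrow> 'a::field mpoly set" where
  "multilinear_invariants d = homogeneous_component d (\<lambda>_. 1) \<inter> invariants"


section \<open>Graded reverse lexicographic order and lead monomials\<close>

text \<open>Smaller rank means larger variable: \<open>y\<^sub>1 > x\<^sub>1 > y\<^sub>2 > x\<^sub>2 > \<dots>\<close>.\<close>

fun var_rank :: "var \<Rightarrow> nat" where
  "var_rank (Y i) = 2 * i"
| "var_rank (X i) = 2 * i + 1"

definition var_less :: "var \<Rightarrow> var \<Rightarrow> bool" where
  "var_less v w \<longleftrightarrow> var_rank w < var_rank v"

definition total_degree :: "monom \<Rightarrow> nat" where
  "total_degree m = (\<Sum>v \<in> Poly_Mapping.keys m. Poly_Mapping.lookup m v)"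

text \<open>In equal degree, the smaller monomial has the larger exponent at the smallest variable where
  the two differ.\<close>

definition grevlex_less :: "monom \<Rightarrow> monom \<Rightarrow> bool" where
  "grevlex_less m n \<longleftrightarrow> total_degree m < total_degree n \<or>
     (total_degree m = total_degree n \<and>
      (\<exists>v. Poly_Mapping.lookup n v < Poly_Mapping.lookup m v \<and>
           (\<forall>w. var_less w v \<longrightarrow> Poly_Mapping.lookup m w = Poly_Mapping.lookup n w)))"

definition LM :: "'a::zero mpoly \<Rightarrow> monom" where
  "LM f = (THE m. m \<in> Poly_Mapping.keys f \<and>
             (\<forall>n \<in> Poly_Mapping.keys f. n \<noteq> m \<longrightarrow> grevlex_less n m))"

text \<open>The order is strict and total, so \<open>LM f\<close> is well defined for \<open>f \<noteq> 0\<close>.\<close>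

lemma var_rank_inj: "var_rank v = var_rank w \<Longrightarrow> v = w"
  by (cases v; cases w; simp; presburger)

lemma grevlex_irrefl: "\<not> grevlex_less m m"
  by (simp add: grevlex_less_def)

lemma grevlex_trans:
  assumes "grevlex_less l m" "grevlex_less m n"
  shows "grevlex_less l n"
proof (cases "total_degree l = total_degree m \<and> total_degree m = total_degree n")
  case True
  from assms(1) True obtain v where v: "Poly_Mapping.lookup m v < Poly_Mapping.lookup l v"
    "\<And>w. var_rank v < var_rank w \<Longrightarrow> Poly_Mapping.lookup l w = Poly_Mapping.lookup m w"
    by (auto simp: grevlex_less_def var_less_def)
  from assms(2) True obtain u where u: "Poly_Mapping.lookup n u < Poly_Mapping.lookup m u"
    "\<And>w. var_rank u < var_rank w \<Longrightarrow> Poly_Mapping.lookup m w = Poly_Mapping.lookup n w"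
    by (auto simp: grevlex_less_def var_less_def)
  consider "var_rank v < var_rank u" | "v = u" | "var_rank u < var_rank v"
    using var_rank_inj linorder_neqE_nat by blast
  then have "\<exists>t. Poly_Mapping.lookup n t < Poly_Mapping.lookup l t \<and>
      (\<forall>w. var_rank t < var_rank w \<longrightarrow> Poly_Mapping.lookup l w = Poly_Mapping.lookup n w)"
  proof cases
    case 1
    then show ?thesis using u v by (intro exI[of _ u]) auto
  next
    case 2
    then show ?thesis using u v by (intro exI[of _ u]) auto
  next
    case 3
    then show ?thesis using u v by (intro exI[of _ v]) auto
  qed
  then show ?thesis using True by (auto simp: grevlex_less_def var_less_def)
next
  case False
  then show ?thesis using assms by (auto simp: grevlex_less_def)
qed

lemma grevlex_total:
  assumes "m \<noteq> n"
  shows "grevlex_less m n \<or> grevlex_less n m"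
proof (cases "total_degree m = total_degree n")
  case True
  let ?D = "{v. Poly_Mapping.lookup m v \<noteq> Poly_Mapping.lookup n v}"
  have "finite ?D"
    by (rule finite_subset[of _ "Poly_Mapping.keys m \<union> Poly_Mapping.keys n"])
      (auto simp: in_keys_iff)
  moreover have "?D \<noteq> {}"
    using assms by (auto intro: poly_mapping_eqI)
  ultimately obtain v where v: "v \<in> ?D" and "var_rank v = Max (var_rank ` ?D)"
    using Max_in[of "var_rank ` ?D"] by fastforce
  then have max: "var_rank w \<le> var_rank v" if "w \<in> ?D" for w
    using \<open>finite ?D\<close> that by simp
  have "Poly_Mapping.lookup m w = Poly_Mapping.lookup n w" if "var_less w v" for w
    using max[of w] that by (auto simp: var_less_def)
  then show ?thesis
    using v True unfolding grevlex_less_def by (metis (mono_tags, lifting) mem_Collect_eq linorder_neqE_nat)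
next
  case False
  then show ?thesis by (auto simp: grevlex_less_def)
qed

lemma LM_greatest:
  assumes "f \<noteq> 0"
  shows "LM f \<in> Poly_Mapping.keys f \<and>
    (\<forall>n \<in> Poly_Mapping.keys f. n \<noteq> LM f \<longrightarrow> grevlex_less n (LM f))"
proof -
  have ex: "\<exists>m \<in> A. \<forall>n \<in> A. n \<noteq> m \<longrightarrow> grevlex_less n m" if "finite A" "A \<noteq> {}" for A
    using that
  proof (induction A rule: finite_ne_induct)
    case (singleton x)
    then show ?case by simp
  next
    case (insert x A)
    then obtain m where m: "m \<in> A" "\<forall>n \<in> A. n \<noteq> m \<longrightarrow> grevlex_less n m" by blast
    have "x \<noteq> m" using insert m by blast
    then consider "grevlex_less x m" | "grevlex_less m x"
      using grevlex_total by blast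
    then show ?case
    proof cases
      case 1
      then show ?thesis using m by (intro bexI[of _ m]) auto
    next
      case 2
      have "grevlex_less n x" if "n \<in> A" for n
        using m that 2 grevlex_trans[of n m x] by (cases "n = m") auto
      then show ?thesis by (intro bexI[of _ x]) auto
    qed
  qed
  let ?P = "\<lambda>m. m \<in> Poly_Mapping.keys f \<and> (\<forall>n \<in> Poly_Mapping.keys f. n \<noteq> m \<longrightarrow> grevlex_less n m)"
  obtain m where m: "?P m"
    using ex[of "Poly_Mapping.keys f"] assms by auto
  have "m' = m" if "?P m'" for m'
    using that m grevlex_trans[of m m' m] grevlex_irrefl[of m] by metis
  with m have "\<exists>!m. ?P m"
    by (rule ex1I)
  then show ?thesis
    unfolding LM_def by (rule theI')
qed


section \<open>Lattice paths\<close>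

datatype step = XStep | YStep

type_synonym lattice_path = "step list"

fun step_vec :: "step \<Rightarrow> int \<times> int" where
  "step_vec XStep = (1, 0)"
| "step_vec YStep = (0, 1)"

definition point :: "lattice_path \<Rightarrow> nat \<Rightarrow> int \<times> int" where
  "point \<gamma> k = (\<Sum>i < k. fst (step_vec (\<gamma> ! i)), \<Sum>i < k. snd (step_vec (\<gamma> ! i)))"

text \<open>Each step joins two neighbouring lines \<open>y = x - h\<close> with \<open>h\<close> an integer, so the path meets
  such a line only in lattice points.\<close>

definition touches :: "lattice_path \<Rightarrow> int \<Rightarrow> bool" where
  "touches \<gamma> h \<longleftrightarrow> (\<exists>k \<le> length \<gamma>. snd (point \<gamma> k) = fst (point \<gamma> k) - h)"

definition height :: "lattice_path \<Rightarrow> int" where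
  "height \<gamma> = Max {h. touches \<gamma> h}"

definition has_finishing_height :: "lattice_path \<Rightarrow> int \<Rightarrow> bool" where
  "has_finishing_height \<gamma> h \<longleftrightarrow>
     snd (point \<gamma> (length \<gamma>)) = fst (point \<gamma> (length \<gamma>)) - h"

definition partial_dyck :: "lattice_path \<Rightarrow> bool" where
  "partial_dyck \<gamma> \<longleftrightarrow> (\<forall>k \<le> length \<gamma>. snd (point \<gamma> k) \<le> fst (point \<gamma> k))"

definition initial_dyck :: "lattice_path \<Rightarrow> int \<Rightarrow> bool" where
  "initial_dyck \<gamma> t \<longleftrightarrow>
     (\<exists>\<alpha> \<beta>. \<gamma> = \<alpha> @ \<beta> \<and> partial_dyck \<alpha> \<and> has_finishing_height \<alpha> t)"

definition PDP_le :: "nat \<Rightarrow> int \<Rightarrow> lattice_path set" where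
  "PDP_le d q = {\<gamma>. length \<gamma> = d \<and> partial_dyck \<gamma> \<and> height \<gamma> \<le> q}"

definition IDP :: "nat \<Rightarrow> int \<Rightarrow> lattice_path set" where
  "IDP d q = {\<gamma>. length \<gamma> = d \<and> initial_dyck \<gamma> q}"

fun step_var :: "step \<Rightarrow> nat \<Rightarrow> var" where
  "step_var XStep i = X i"
| "step_var YStep i = Y i"

text \<open>The product \<open>z\<^sub>1 \<cdots> z\<^sub>d\<close> as an exponent vector.\<close>

definition Lam :: "lattice_path \<Rightarrow> monom" where
  "Lam \<gamma> = (\<Sum>i \<in> {1..length \<gamma>}. Poly_Mapping.single (step_var (\<gamma> ! (i - 1)) i) 1)"

end

(* Write a multilinear f in d + 1 variable pairs as a y + b x, where x, y is the last pair, and put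
   D = sigma - 1. The lead monomial of f is LM(a) y, or LM(b) x if a = 0, and
   D^j (a y + b x) = (D^j a) y + (j D^(j-1) (sigma a) + D^j b) x. Hence, for j < p, with
   K(d, j) = ker D Int im D^j:
     b x lies in K(d+1, j) iff b lies in K(d, j-1), and
     a is the y-part of an element of K(d+1, j) iff a lies in K(d, min (j+1) (p-1)),
   the second because j + 1 is invertible for j < p - 1, while p = 0 and D^p = 0 for j = p - 1.
   The partial Dyck paths of height at most p - 2 and finishing height at least j, together with all
   initial Dyck paths of escape height p - 1, obey the same recursion in the last step. *)

theory Submission
  imports Defs
begin

section \<open>Lattice paths described by their distance below the diagonal, and how they grow by a
  last step\<close>

section \<open>Paths\<close>

text \<open>The line y = x - h is the level set of value h, so height, finishing height and the Dyck
  condition all become conditions on this one integer function.\<close>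

definition elevation :: "lattice_path \<Rightarrow> nat \<Rightarrow> int" where
  "elevation \<gamma> k = fst (point \<gamma> k) - snd (point \<gamma> k)"

lemma elevation_0 [simp]: "elevation \<gamma> 0 = 0"
  by (simp add: elevation_def point_def)

lemma point_append: "k \<le> length \<alpha> \<Longrightarrow> point (\<alpha> @ \<beta>) k = point \<alpha> k"
  by (simp add: point_def nth_append)

lemma elevation_append: "k \<le> length \<alpha> \<Longrightarrow> elevation (\<alpha> @ \<beta>) k = elevation \<alpha> k"
  by (simp add: elevation_def point_append)

lemma elevation_snoc:
  "elevation (\<gamma> @ [s]) (Suc (length \<gamma>)) =
     elevation \<gamma> (length \<gamma>) + (case s of XStep \<Rightarrow> 1 | YStep \<Rightarrow> - 1)"
  by (cases s) (simp_all add: elevation_def point_def nth_append)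

lemma partial_dyck_iff: "partial_dyck \<gamma> \<longleftrightarrow> (\<forall>k \<le> length \<gamma>. 0 \<le> elevation \<gamma> k)"
  by (simp add: partial_dyck_def elevation_def)

text \<open>The touched levels are the values of the elevation: a finite nonempty set, so bounding
  its \<open>Max\<close> bounds each of them.\<close>

lemma height_le_iff: "height \<gamma> \<le> q \<longleftrightarrow> (\<forall>k \<le> length \<gamma>. elevation \<gamma> k \<le> q)"
proof -
  have "{h. touches \<gamma> h} = elevation \<gamma> ` {..length \<gamma>}"
    by (force simp: touches_def elevation_def image_iff)
  then show ?thesis
    by (simp add: height_def) blast
qed

text \<open>The splitting of the path is replaced by the time k at which the prefix ends, a form
  suited to induction on the last step.\<close>

lemma initial_dyck_iff:
  "initial_dyck \<gamma> t \<longleftrightarrow> (\<exists>k \<le> length \<gamma>. elevation \<gamma> k = t \<and> (\<forall>i \<le> k. 0 \<le> elevation \<gamma> i))"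
  (is "?L \<longleftrightarrow> ?R")
proof
  assume ?L
  then obtain \<alpha> \<beta> where "\<gamma> = \<alpha> @ \<beta>" "partial_dyck \<alpha>" "elevation \<alpha> (length \<alpha>) = t"
    by (auto simp: initial_dyck_def has_finishing_height_def elevation_def)
  then show ?R
    by (intro exI[of _ "length \<alpha>"]) (simp add: elevation_append partial_dyck_iff)
next
  assume ?R
  then obtain k where k: "k \<le> length \<gamma>" "elevation \<gamma> k = t" "\<forall>i \<le> k. 0 \<le> elevation \<gamma> i"
    by blast
  have eq: "elevation (take k \<gamma>) i = elevation \<gamma> i" if "i \<le> k" for i
    using that k(1) elevation_append[of i "take k \<gamma>" "drop k \<gamma>"] by simp
  have "partial_dyck (take k \<gamma>)"
    using k by (simp add: partial_dyck_iff eq)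
  moreover have "has_finishing_height (take k \<gamma>) t"
    using k eq[of k] by (simp add: has_finishing_height_def elevation_def min_def)
  ultimately show ?L
    unfolding initial_dyck_def by (intro exI[of _ "take k \<gamma>"] exI[of _ "drop k \<gamma>"]) simp
qed

text \<open>Partial Dyck paths that never reach level q. The strict bound with a natural q turns
  height at most p - 2 into q = p - 1.\<close>

definition bounded_dyck :: "nat \<Rightarrow> lattice_path \<Rightarrow> bool" where
  "bounded_dyck q \<gamma> \<longleftrightarrow> (\<forall>k \<le> length \<gamma>. 0 \<le> elevation \<gamma> k \<and> elevation \<gamma> k < int q)"

lemma PDP_le_eq: "PDP_le d (int q - 1) = {\<gamma>. length \<gamma> = d \<and> bounded_dyck q \<gamma>}"
  proof -
  have "height \<gamma> \<le> int q - 1 \<longleftrightarrow> (\<forall>k \<le> length \<gamma>. elevation \<gamma> k < int q)" for \<gamma>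
    unfolding height_le_iff by auto
  then show ?thesis
    unfolding PDP_le_def partial_dyck_iff bounded_dyck_def by blast
qed

text \<open>An escaping path visits level q, which a bounded one avoids; this makes the union in the
  theorem disjoint.\<close>

lemma bounded_not_initial_dyck: "bounded_dyck q \<gamma> \<Longrightarrow> \<not> initial_dyck \<gamma> (int q)"
  by (force simp: bounded_dyck_def initial_dyck_iff)

lemma bounded_dyck_Nil: "bounded_dyck q [] \<longleftrightarrow> 0 < q"
  by (simp add: bounded_dyck_def)

lemma initial_dyck_Nil: "initial_dyck [] (int q) \<longleftrightarrow> q = 0"
  by (auto simp: initial_dyck_iff)

lemma all_le_Suc: "(\<forall>k \<le> Suc n. P k) \<longleftrightarrow> (\<forall>k \<le> n. P k) \<and> P (Suc n)"
  by (auto simp: le_Suc_eq)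

lemma ex_le_Suc: "(\<exists>k \<le> Suc n. P k) \<longleftrightarrow> (\<exists>k \<le> n. P k) \<or> P (Suc n)"
  by (auto simp: le_Suc_eq)

lemma partial_dyck_snoc:
  "partial_dyck (\<gamma> @ [s]) \<longleftrightarrow>
     partial_dyck \<gamma> \<and> 0 \<le> elevation (\<gamma> @ [s]) (Suc (length \<gamma>))"
  by (simp add: partial_dyck_iff all_le_Suc elevation_append)

lemma bounded_dyck_snoc:
  "bounded_dyck q (\<gamma> @ [s]) \<longleftrightarrow> bounded_dyck q \<gamma> \<and>
     0 \<le> elevation (\<gamma> @ [s]) (Suc (length \<gamma>)) \<and>
     elevation (\<gamma> @ [s]) (Suc (length \<gamma>)) < int q"
  by (simp add: bounded_dyck_def all_le_Suc elevation_append)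

text \<open>The Dyck prefix that reaches level t either ends before the last step or is the whole
  path.\<close>

lemma initial_dyck_snoc:
  "initial_dyck (\<gamma> @ [s]) t \<longleftrightarrow> initial_dyck \<gamma> t \<or>
     partial_dyck (\<gamma> @ [s]) \<and> elevation (\<gamma> @ [s]) (Suc (length \<gamma>)) = t"
proof -
  have "(\<exists>k \<le> length \<gamma>. elevation (\<gamma> @ [s]) k = t \<and> (\<forall>i \<le> k. 0 \<le> elevation (\<gamma> @ [s]) i))
      \<longleftrightarrow> initial_dyck \<gamma> t"
    unfolding initial_dyck_iff by (intro ex_cong1 conj_cong refl) (simp_all add: elevation_append)
  then show ?thesis
    unfolding initial_dyck_iff[of "\<gamma> @ [s]"] length_append_singleton ex_le_Suc partial_dyck_iff
    by auto
qed

text \<open>A discrete intermediate value argument: elevation changes by one per step, so a path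
  cannot get past level q without landing on it.\<close>

lemma partial_dyck_cases:
  "partial_dyck \<gamma> \<Longrightarrow> bounded_dyck q \<gamma> \<or> initial_dyck \<gamma> (int q)"
proof (induction \<gamma> rule: rev_induct)
  case Nil
  then show ?case by (auto simp: bounded_dyck_Nil initial_dyck_Nil)
next
  case (snoc s \<gamma>)
  then show ?case
    unfolding partial_dyck_snoc initial_dyck_snoc bounded_dyck_snoc elevation_snoc
    by (auto simp: bounded_dyck_def split: step.splits)
qed

text \<open>With \<open>q = p - 1\<close>, these turn out to be the paths of the lead monomials of \<open>socle_layer d j\<close>.\<close>

definition good_path :: "nat \<Rightarrow> nat \<Rightarrow> lattice_path \<Rightarrow> bool" where
  "good_path q j \<gamma> \<longleftrightarrow> initial_dyck \<gamma> (int q) \<or>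
     bounded_dyck q \<gamma> \<and> int j \<le> elevation \<gamma> (length \<gamma>)"

lemma good_path_0: "good_path q 0 \<gamma> \<longleftrightarrow> initial_dyck \<gamma> (int q) \<or> bounded_dyck q \<gamma>"
  by (auto simp: good_path_def bounded_dyck_def)

lemma good_path_Nil: "0 < q \<Longrightarrow> good_path q j [] \<longleftrightarrow> j = 0"
  by (simp add: good_path_def bounded_dyck_Nil initial_dyck_Nil)

lemma bounded_dyck_imp_partial_dyck: "bounded_dyck q \<gamma> \<Longrightarrow> partial_dyck \<gamma>"
  by (simp add: bounded_dyck_def partial_dyck_iff)

lemma bounded_dyck_last: "bounded_dyck q \<gamma> \<Longrightarrow>
    0 \<le> elevation \<gamma> (length \<gamma>) \<and> elevation \<gamma> (length \<gamma>) < int q"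
  by (simp add: bounded_dyck_def)

text \<open>For a bounded path ending at level e, e + 1 >= j means e >= j - 1. If e + 1 = q, the new
  path escapes instead, and j <= q gives e >= j - 1 as well. For j = 0 the truncated j - 1 is 0,
  which every bounded path satisfies.\<close>

lemma good_path_XStep:
  assumes "j \<le> q"
  shows "good_path q j (\<gamma> @ [XStep]) \<longleftrightarrow> good_path q (j - 1) \<gamma>"
proof (cases "bounded_dyck q \<gamma>")
  case True
  then show ?thesis
    using bounded_dyck_last[OF True] bounded_dyck_imp_partial_dyck[OF True] assms
    unfolding good_path_def initial_dyck_snoc bounded_dyck_snoc partial_dyck_snoc
      length_append_singleton elevation_snoc
    by auto
next
  \<comment> \<open>If \<gamma> is partial Dyck, it has already escaped; otherwise it has left the
    region and a further step cannot produce a new Dyck prefix.\<close>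
  case False
  then show ?thesis
    using partial_dyck_cases[of \<gamma> q]
    unfolding good_path_def initial_dyck_snoc bounded_dyck_snoc partial_dyck_snoc
    by blast
qed

text \<open>For a bounded path ending at level e, e - 1 >= j means e >= j + 1, which also keeps the
  new end nonnegative. Capping at q changes nothing on bounded paths, since for j = q neither e >= q
  + 1 nor e >= q can hold.\<close>

lemma good_path_YStep:
  assumes "j \<le> q"
  shows "good_path q j (\<gamma> @ [YStep]) \<longleftrightarrow> good_path q (min (Suc j) q) \<gamma>"
proof (cases "bounded_dyck q \<gamma>")
  case True
  then show ?thesis
    using bounded_dyck_last[OF True] bounded_dyck_imp_partial_dyck[OF True] assms
    unfolding good_path_def initial_dyck_snoc bounded_dyck_snoc partial_dyck_snoc
      length_append_singleton elevation_snoc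
    by auto
next
  case False
  then show ?thesis
    using partial_dyck_cases[of \<gamma> q]
    unfolding good_path_def initial_dyck_snoc bounded_dyck_snoc partial_dyck_snoc
    by blast
qed

lemma good_path_Suc_eq:
  assumes "j \<le> q"
  shows "{\<gamma>. length \<gamma> = Suc d \<and> good_path q j \<gamma>} =
    (\<lambda>\<gamma>. \<gamma> @ [XStep]) ` {\<gamma>. length \<gamma> = d \<and> good_path q (j - 1) \<gamma>} \<union>
    (\<lambda>\<gamma>. \<gamma> @ [YStep]) ` {\<gamma>. length \<gamma> = d \<and> good_path q (min (Suc j) q) \<gamma>}"
  (is "?L = ?R")
proof
  show "?L \<subseteq> ?R"
  proof
    fix \<gamma> assume \<gamma>: "\<gamma> \<in> ?L"
    then obtain \<alpha> s where "\<gamma> = \<alpha> @ [s]" by (cases \<gamma> rule: rev_cases) auto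
    with \<gamma> show "\<gamma> \<in> ?R"
      using good_path_XStep[OF assms] good_path_YStep[OF assms] by (cases s) auto
  qed
  show "?R \<subseteq> ?L"
    using good_path_XStep[OF assms] good_path_YStep[OF assms] by auto
qed

section \<open>Recursion and injectivity of \<Lambda>\<close>

lemma Lam_Nil [simp]: "Lam [] = 0"
  by (simp add: Lam_def)

lemma Lam_snoc:
  "Lam (\<gamma> @ [s]) = Lam \<gamma> + Poly_Mapping.single (step_var s (Suc (length \<gamma>))) 1"
proof -
  have "(\<Sum>i = 1..length \<gamma>. Poly_Mapping.single (step_var ((\<gamma> @ [s]) ! (i - 1)) i) (1::nat)) = Lam \<gamma>"
    unfolding Lam_def by (intro sum.cong refl) (auto simp: nth_append)
  then show ?thesis
    by (simp add: Lam_def atLeastAtMostSuc_conv nth_append add.commute)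
qed

text \<open>This recovers the path from its monomial: with only two kinds of steps, the exponent of
  the x-variable decides. Steps are counted from 0, variables from 1.\<close>

lemma lookup_Lam_X:
  assumes "i < length \<gamma>"
  shows "Poly_Mapping.lookup (Lam \<gamma>) (X (Suc i)) = (if \<gamma> ! i = XStep then 1 else 0)"
proof -
  have "Poly_Mapping.lookup (Poly_Mapping.single (step_var (\<gamma> ! (k - 1)) k) 1) (X (Suc i)) =
      (if k = Suc i then if \<gamma> ! i = XStep then 1 else 0 else 0 :: nat)" for k
    by (cases "\<gamma> ! (k - 1)") (auto simp: lookup_single when_def)
  with assms show ?thesis
    by (simp add: Lam_def lookup_sum)
qed

lemma inj_on_Lam: "inj_on Lam {\<gamma>. length \<gamma> = d}"
proof (rule inj_onI)
  fix \<alpha> \<beta> :: lattice_path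
  assume asm: "\<alpha> \<in> {\<gamma>. length \<gamma> = d}" "\<beta> \<in> {\<gamma>. length \<gamma> = d}" "Lam \<alpha> = Lam \<beta>"
  then have len: "length \<alpha> = length \<beta>" by simp
  have "\<alpha> ! i = \<beta> ! i" if "i < length \<alpha>" for i
    using lookup_Lam_X[of i \<alpha>] lookup_Lam_X[of i \<beta>] that asm(3) len
    by (cases "\<alpha> ! i"; cases "\<beta> ! i") simp_all
  with len show "\<alpha> = \<beta>" by (rule nth_equalityI)
qed


section \<open>Monomials of multidegree (1,...,1) and their order\<close>

section \<open>Multilinear monomials\<close>

text \<open>Prescribing degree 0 outside {1..d} also confines the variables to the first d pairs, so
  \<open>poly_ring\<close> is encoded at the same time.\<close>

definition ml_monoms :: "nat \<Rightarrow> monom set" where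
  "ml_monoms d = {m. \<forall>i. multidegree m i = (if i \<in> {1..d} then 1 else 0)}"

lemma multidegree_add: "multidegree (m + n) i = multidegree m i + multidegree n i"
  by (simp add: multidegree_def lookup_add)

lemma multidegree_single:
  "multidegree (Poly_Mapping.single v e) i = (if idx v = i then e else 0)"
  by (cases v) (auto simp: multidegree_def lookup_single when_def)

lemma idx_step_var [simp]: "idx (step_var s i) = i"
  by (cases s) simp_all

lemma ml_monoms_0: "ml_monoms 0 = {0}"
proof -
  have "m = 0" if m: "\<And>i. multidegree m i = 0" for m
  proof (rule poly_mapping_eqI)
    fix v show "Poly_Mapping.lookup m v = Poly_Mapping.lookup 0 v"
      using m[of "idx v"] by (cases v) (simp_all add: multidegree_def)
  qed
  then show ?thesis
    by (auto simp: ml_monoms_def) (simp add: multidegree_def)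
qed

lemma ml_monoms_add_step_var:
  "n \<in> ml_monoms d \<Longrightarrow> n + Poly_Mapping.single (step_var s (Suc d)) 1 \<in> ml_monoms (Suc d)"
  by (auto simp: ml_monoms_def multidegree_add multidegree_single)

lemma ml_monoms_SucE:
  assumes "m \<in> ml_monoms (Suc d)"
  obtains n s where "n \<in> ml_monoms d" "m = n + Poly_Mapping.single (step_var s (Suc d)) 1"
proof -
  have "multidegree m (Suc d) = 1"
    using assms by (simp add: ml_monoms_def)
  then consider "Poly_Mapping.lookup m (X (Suc d)) = 1" | "Poly_Mapping.lookup m (Y (Suc d)) = 1"
    unfolding multidegree_def by linarith
  then have "\<exists>s. Poly_Mapping.lookup m (step_var s (Suc d)) = 1"
    by cases (metis step_var.simps(1), metis step_var.simps(2))
  then obtain s where s: "Poly_Mapping.lookup m (step_var s (Suc d)) = 1"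
    by blast
  \<comment> \<open>Subtraction of exponents is truncated, but here it is exact because the exponent
    of this variable is 1.\<close>
  define n where "n = m - Poly_Mapping.single (step_var s (Suc d)) 1"
  have m: "m = n + Poly_Mapping.single (step_var s (Suc d)) 1"
    using s by (intro poly_mapping_eqI) (auto simp: n_def lookup_add lookup_minus lookup_single when_def)
  have "multidegree n i = (if i \<in> {1..d} then 1 else 0)" for i
  proof -
    have "multidegree m i = (if i \<in> {1..Suc d} then 1 else 0)"
      using assms by (simp add: ml_monoms_def)
    then show ?thesis
      by (cases "i = Suc d") (auto simp: m multidegree_add multidegree_single split: if_splits)
  qed
  then have "n \<in> ml_monoms d"
    by (simp add: ml_monoms_def)
  with m show ?thesis by (rule that[rotated])
qed

lemma total_degree_superset:
  "\<lbrakk>finite S; Poly_Mapping.keys m \<subseteq> S\<rbrakk> \<Longrightarrow> total_degree m = (\<Sum>v\<in>S. Poly_Mapping.lookup m v)"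
  unfolding total_degree_def by (rule sum.mono_neutral_left) (auto simp: in_keys_iff)

lemma total_degree_add: "total_degree (m + n) = total_degree m + total_degree n"
  using total_degree_superset[of "Poly_Mapping.keys m \<union> Poly_Mapping.keys n"] keys_add[of m n]
  by (simp add: lookup_add sum.distrib)

lemma total_degree_single: "total_degree (Poly_Mapping.single v e) = e"
  by (simp add: total_degree_def)

lemma ml_monoms_total_degree: "m \<in> ml_monoms d \<Longrightarrow> total_degree m = d"
proof (induction d arbitrary: m)
  case 0
  then show ?case by (simp add: ml_monoms_0 total_degree_def)
next
  case (Suc d)
  from Suc.prems obtain n s where "n \<in> ml_monoms d"
    "m = n + Poly_Mapping.single (step_var s (Suc d)) 1"
    by (rule ml_monoms_SucE)
  then show ?case
    using Suc.IH[of n] by (simp add: total_degree_add total_degree_single)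
qed

lemma ml_monoms_lookup_0:
  "\<lbrakk>m \<in> ml_monoms d; d < idx v\<rbrakk> \<Longrightarrow> Poly_Mapping.lookup m v = 0"
  by (cases v) (auto simp: ml_monoms_def multidegree_def dest!: spec[of _ "idx v"])

lemma grevlex_less_add_right: "grevlex_less m n \<Longrightarrow> grevlex_less (m + k) (n + k)"
  by (auto simp: grevlex_less_def total_degree_add lookup_add)

text \<open>Both monomials have degree d + 1. All variables below x_{d+1} have index above d + 1 and
  so exponent 0 on both sides; hence x_{d+1} decides, and the monomial containing it is the smaller
  one.\<close>

lemma grevlex_less_last_step:
  assumes "m \<in> ml_monoms d" "n \<in> ml_monoms d"
  shows "grevlex_less (m + Poly_Mapping.single (X (Suc d)) 1) (n + Poly_Mapping.single (Y (Suc d)) 1)"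
proof -
  have "Poly_Mapping.lookup (m + Poly_Mapping.single (X (Suc d)) 1) w =
      Poly_Mapping.lookup (n + Poly_Mapping.single (Y (Suc d)) 1) w"
    if "var_less w (X (Suc d))" for w
    using that assms[THEN ml_monoms_lookup_0, of w]
    by (cases w) (auto simp: var_less_def lookup_add lookup_single when_def)
  then show ?thesis
    using assms ml_monoms_lookup_0[OF assms(2), of "X (Suc d)"]
    by (auto simp: grevlex_less_def total_degree_add total_degree_single ml_monoms_total_degree
        lookup_add lookup_single intro!: exI[of _ "X (Suc d)"])
qed

lemma LM_eqI:
  assumes "m \<in> Poly_Mapping.keys f" "\<And>n. n \<in> Poly_Mapping.keys f \<Longrightarrow> n \<noteq> m \<Longrightarrow> grevlex_less n m"
  shows "LM f = m"
proof -
  have "f \<noteq> 0" using assms(1) by auto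
  then show ?thesis
    using LM_greatest[of f] assms grevlex_trans grevlex_irrefl by metis
qed


section \<open>Multilinear polynomials as pairs of coefficients of the last two variables\<close>

section \<open>Multilinear polynomials\<close>

definition ml_polys :: "nat \<Rightarrow> 'a::field mpoly set" where
  "ml_polys d = {f. Poly_Mapping.keys f \<subseteq> ml_monoms d}"

lemma homogeneous_component_eq_ml_polys: "homogeneous_component d (\<lambda>_. 1) = ml_polys d"
proof -
  have "m \<in> ml_monoms d \<longleftrightarrow>
      (\<forall>v \<in> Poly_Mapping.keys m. idx v \<in> {1..d}) \<and> (\<forall>i \<in> {1..d}. multidegree m i = 1)" for m
  proof
    assume m: "m \<in> ml_monoms d"
    have "idx v \<in> {1..d}" if "v \<in> Poly_Mapping.keys m" for v
    proof -
      have "multidegree m (idx v) \<noteq> 0"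
        using that by (cases v) (auto simp: multidegree_def in_keys_iff)
      then show ?thesis using m by (auto simp: ml_monoms_def split: if_splits)
    qed
    then show "(\<forall>v \<in> Poly_Mapping.keys m. idx v \<in> {1..d}) \<and> (\<forall>i \<in> {1..d}. multidegree m i = 1)"
      using m by (auto simp: ml_monoms_def)
  next
    assume m: "(\<forall>v \<in> Poly_Mapping.keys m. idx v \<in> {1..d}) \<and> (\<forall>i \<in> {1..d}. multidegree m i = 1)"
    have "multidegree m i = 0" if "i \<notin> {1..d}" for i
      using m that by (metis multidegree_def idx.simps add_0 not_in_keys_iff_lookup_eq_zero)
    with m show "m \<in> ml_monoms d"
      by (simp add: ml_monoms_def)
  qed
  then show ?thesis
    unfolding homogeneous_component_def poly_ring_def ml_polys_def by blast
qed

lemma ml_polys_0 [simp]: "0 \<in> ml_polys d"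
  by (simp add: ml_polys_def)

lemma ml_polys_add: "f \<in> ml_polys d \<Longrightarrow> g \<in> ml_polys d \<Longrightarrow> f + g \<in> ml_polys d"
  using keys_add[of f g] by (auto simp: ml_polys_def)

lemma ml_polys_diff: "f \<in> ml_polys d \<Longrightarrow> g \<in> ml_polys d \<Longrightarrow> f - g \<in> ml_polys d"
  by (auto simp: ml_polys_def in_keys_iff lookup_minus subset_iff) (metis diff_self)

lemma lookup_const_mult: "Poly_Mapping.lookup (const c * f) m = c * Poly_Mapping.lookup f m"
  for f :: "'a::field mpoly"
proof -
  have "const c * f = Poly_Mapping.map ((*) c) f"
    unfolding const_def by (rule mult_map_scale_conv_mult[symmetric])
  then show ?thesis by (simp add: map.rep_eq when_def)
qed

lemma ml_polys_const_mult: "f \<in> ml_polys d \<Longrightarrow> const c * f \<in> ml_polys d"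
  by (auto simp: ml_polys_def in_keys_iff lookup_const_mult subset_iff)

lemma of_nat_eq_const: "(of_nat n :: 'a::field mpoly) = const (of_nat n)"
  by (simp add: const_def)

lemma ml_polys_of_nat_mult: "f \<in> ml_polys d \<Longrightarrow> of_nat n * f \<in> ml_polys d"
  by (simp only: of_nat_eq_const ml_polys_const_mult)

lemma lookup_mult_var_poly:
  "Poly_Mapping.lookup (f * var_poly v) m =
     (\<Sum>n\<in>Poly_Mapping.keys f.
        if n + Poly_Mapping.single v 1 = m then Poly_Mapping.lookup f n else 0)"
  for f :: "'a::field mpoly"
proof -
  have "f * var_poly v = (\<Sum>n\<in>Poly_Mapping.keys f.
      Poly_Mapping.single n (Poly_Mapping.lookup f n)) * var_poly v"
    by (simp flip: mpoly_eq_sum_singles)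
  also have "\<dots> = (\<Sum>n\<in>Poly_Mapping.keys f.
      Poly_Mapping.single (n + Poly_Mapping.single v 1) (Poly_Mapping.lookup f n))"
    by (simp add: sum_distrib_right var_poly_def mult_single)
  finally show ?thesis
    by (simp add: lookup_sum lookup_single when_def)
qed

lemma lookup_mult_var_poly_add:
  "Poly_Mapping.lookup (f * var_poly v) (n + Poly_Mapping.single v 1) = Poly_Mapping.lookup f n"
  for f :: "'a::field mpoly"
  by (simp add: lookup_mult_var_poly in_keys_iff)

lemma lookup_mult_var_poly_0:
  "Poly_Mapping.lookup m v = 0 \<Longrightarrow> Poly_Mapping.lookup (f * var_poly v) m = 0"
  for f :: "'a::field mpoly"
  unfolding lookup_mult_var_poly by (intro sum.neutral) (auto simp: lookup_add)

text \<open>Identifies pairs over \<open>ml_polys d\<close> with \<open>ml_polys (Suc d)\<close>: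
  \<open>ext_poly_inject\<close> gives uniqueness and \<open>ml_polys_SucE\<close> existence of the
  pair.\<close>

definition ext_poly :: "nat \<Rightarrow> 'a::field mpoly \<Rightarrow> 'a mpoly \<Rightarrow> 'a mpoly" where
  "ext_poly d a b = a * var_poly (Y (Suc d)) + b * var_poly (X (Suc d))"

text \<open>The other variable of the last pair has exponent 0 in this monomial, so the other
  summand contributes nothing.\<close>

lemma lookup_ext_poly:
  assumes "n \<in> ml_monoms d"
  shows "Poly_Mapping.lookup (ext_poly d a b) (n + Poly_Mapping.single (step_var s (Suc d)) 1) =
    Poly_Mapping.lookup (case s of XStep \<Rightarrow> b | YStep \<Rightarrow> a) n"
proof (cases s)
  case XStep
  have "Poly_Mapping.lookup (n + Poly_Mapping.single (X (Suc d)) 1) (Y (Suc d)) = 0"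
    using ml_monoms_lookup_0[OF assms, of "Y (Suc d)"] by (simp add: lookup_add lookup_single)
  with XStep show ?thesis
    using lookup_mult_var_poly_add[of b "X (Suc d)" n]
    by (simp add: ext_poly_def lookup_add[of "_ * _"] lookup_mult_var_poly_0 del: One_nat_def)
next
  case YStep
  have "Poly_Mapping.lookup (n + Poly_Mapping.single (Y (Suc d)) 1) (X (Suc d)) = 0"
    using ml_monoms_lookup_0[OF assms, of "X (Suc d)"] by (simp add: lookup_add lookup_single)
  with YStep show ?thesis
    using lookup_mult_var_poly_add[of a "Y (Suc d)" n]
    by (simp add: ext_poly_def lookup_add[of "_ * _"] lookup_mult_var_poly_0 del: One_nat_def)
qed

lemma mult_var_poly_in_ml_polys:
  assumes "f \<in> ml_polys d"
  shows "f * var_poly (step_var s (Suc d)) \<in> ml_polys (Suc d)"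
proof -
  have "Poly_Mapping.keys (f * var_poly (step_var s (Suc d)))
      \<subseteq> {n + Poly_Mapping.single (step_var s (Suc d)) 1 | n. n \<in> Poly_Mapping.keys f}"
    using keys_mult[of f "var_poly (step_var s (Suc d))"] by (fastforce simp: var_poly_def)
  also have "\<dots> \<subseteq> ml_monoms (Suc d)"
    using assms ml_monoms_add_step_var by (auto simp: ml_polys_def simp del: One_nat_def)
  finally show ?thesis by (simp add: ml_polys_def)
qed

lemma ext_poly_in_ml_polys:
  "a \<in> ml_polys d \<Longrightarrow> b \<in> ml_polys d \<Longrightarrow> ext_poly d a b \<in> ml_polys (Suc d)"
  using mult_var_poly_in_ml_polys[of a d YStep] mult_var_poly_in_ml_polys[of b d XStep]
  by (simp add: ext_poly_def ml_polys_add)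

lemma ext_poly_inject:
  assumes "a \<in> ml_polys d" "b \<in> ml_polys d" "a' \<in> ml_polys d" "b' \<in> ml_polys d"
  shows "ext_poly d a b = ext_poly d a' b' \<longleftrightarrow> a = a' \<and> b = b'"
proof
  assume eq: "ext_poly d a b = ext_poly d a' b'"
  have "Poly_Mapping.lookup a n = Poly_Mapping.lookup a' n \<and>
    Poly_Mapping.lookup b n = Poly_Mapping.lookup b' n" for n
  proof (cases "n \<in> ml_monoms d")
    case True
    then show ?thesis
      using lookup_ext_poly[OF True, of a b YStep] lookup_ext_poly[OF True, of a' b' YStep]
        lookup_ext_poly[OF True, of a b XStep] lookup_ext_poly[OF True, of a' b' XStep] eq
      by simp_all
  next
    case False
    then have "n \<notin> Poly_Mapping.keys a" "n \<notin> Poly_Mapping.keys b"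
      "n \<notin> Poly_Mapping.keys a'" "n \<notin> Poly_Mapping.keys b'"
      using assms by (auto simp: ml_polys_def)
    then show ?thesis
      by (simp_all add: in_keys_iff)
  qed
  then show "a = a' \<and> b = b'" by (auto intro: poly_mapping_eqI)
qed simp

lemma ext_poly_0 [simp]: "ext_poly d 0 0 = 0"
  by (simp add: ext_poly_def)

lemma ext_poly_eq_0_iff:
  "a \<in> ml_polys d \<Longrightarrow> b \<in> ml_polys d \<Longrightarrow> ext_poly d a b = 0 \<longleftrightarrow> a = 0 \<and> b = 0"
  using ext_poly_inject[of a d b 0 0] by simp

lemma ext_poly_add: "ext_poly d a b + ext_poly d a' b' = ext_poly d (a + a') (b + b')"
  by (simp add: ext_poly_def algebra_simps)

lemma ext_poly_diff: "ext_poly d a b - ext_poly d a' b' = ext_poly d (a - a') (b - b')"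
  by (simp add: ext_poly_def algebra_simps)

lemma ml_polys_SucE:
  assumes "f \<in> ml_polys (Suc d)"
  obtains a b where "a \<in> ml_polys d" "b \<in> ml_polys d" "f = ext_poly d a b"
proof -
  \<comment> \<open>Generalised from f to sums of terms over any finite set of multilinear
    monomials, so that induction on the set applies; each new term joins exactly one of the two
    parts.\<close>
  have "\<exists>a \<in> ml_polys d. \<exists>b \<in> ml_polys d. (\<Sum>m\<in>A. Poly_Mapping.single m (c m)) = ext_poly d a b"
    if "finite A" "A \<subseteq> ml_monoms (Suc d)" for A and c :: "monom \<Rightarrow> 'a"
    using that
  proof (induction A rule: finite_induct)
    case empty
    show ?case by (intro bexI[of _ 0]) simp_all
  next
    case (insert m A)
    then obtain a b where ab: "a \<in> ml_polys d" "b \<in> ml_polys d"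
      "(\<Sum>m\<in>A. Poly_Mapping.single m (c m)) = ext_poly d a b" by auto
    obtain n s where n: "n \<in> ml_monoms d" "m = n + Poly_Mapping.single (step_var s (Suc d)) 1"
      using insert.prems ml_monoms_SucE by blast
    have "\<exists>a' \<in> ml_polys d. \<exists>b' \<in> ml_polys d. Poly_Mapping.single m (c m) = ext_poly d a' b'"
    proof -
      have 1: "Poly_Mapping.single n (c m) \<in> ml_polys d"
        using n by (auto simp: ml_polys_def)
      have 2: "Poly_Mapping.single m (c m) =
          Poly_Mapping.single n (c m) * var_poly (step_var s (Suc d))"
        using n by (simp add: var_poly_def mult_single)
      show ?thesis
      proof (cases s)
        case XStep
        with 1 2 show ?thesis
          by (intro bexI[of _ 0] bexI[of _ "Poly_Mapping.single n (c m)"]) (simp_all add: ext_poly_def)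
      next
        case YStep
        with 1 2 show ?thesis
          by (intro bexI[of _ 0] bexI[of _ "Poly_Mapping.single n (c m)"]) (simp_all add: ext_poly_def)
      qed
    qed
    then obtain a' b' where "a' \<in> ml_polys d" "b' \<in> ml_polys d"
      "Poly_Mapping.single m (c m) = ext_poly d a' b'" by blast
    then show ?case
      using ab insert.hyps by (intro bexI[of _ "a' + a"] bexI[of _ "b' + b"])
        (simp_all add: ext_poly_add ml_polys_add)
  qed
  from this[of "Poly_Mapping.keys f" "Poly_Mapping.lookup f"] assms that show thesis
    unfolding mpoly_eq_sum_singles[symmetric] by (auto simp: ml_polys_def)
qed

lemma ext_poly_keysE:
  assumes "a \<in> ml_polys d" "b \<in> ml_polys d" "m \<in> Poly_Mapping.keys (ext_poly d a b)"
  obtains n s where "n \<in> ml_monoms d" "m = n + Poly_Mapping.single (step_var s (Suc d)) 1"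
    "n \<in> Poly_Mapping.keys (case s of XStep \<Rightarrow> b | YStep \<Rightarrow> a)"
proof -
  have "m \<in> ml_monoms (Suc d)"
    using ext_poly_in_ml_polys[OF assms(1,2)] assms(3) by (auto simp: ml_polys_def)
  then obtain n s where n: "n \<in> ml_monoms d" "m = n + Poly_Mapping.single (step_var s (Suc d)) 1"
    by (rule ml_monoms_SucE)
  have "n \<in> Poly_Mapping.keys (case s of XStep \<Rightarrow> b | YStep \<Rightarrow> a)"
    using assms(3) unfolding n(2) in_keys_iff lookup_ext_poly[OF n(1)] .
  with n show thesis by (rule that)
qed

lemma LM_in_ml_monoms: "f \<in> ml_polys d \<Longrightarrow> f \<noteq> 0 \<Longrightarrow> LM f \<in> ml_monoms d"
  using LM_greatest[of f] by (auto simp: ml_polys_def)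

text \<open>By \<open>grevlex_less_last_step\<close> every term of the y-part beats every term of
  the x-part, and multiplication by a fixed monomial preserves the order within the y-part.\<close>

lemma LM_ext_poly_Y:
  assumes "a \<in> ml_polys d" "b \<in> ml_polys d" "a \<noteq> 0"
  shows "LM (ext_poly d a b) = LM a + Poly_Mapping.single (Y (Suc d)) 1"
proof (rule LM_eqI)
  note LMa = LM_in_ml_monoms[OF assms(1,3)]
  show "LM a + Poly_Mapping.single (Y (Suc d)) 1 \<in> Poly_Mapping.keys (ext_poly d a b)"
    using lookup_ext_poly[OF LMa, of a b YStep] LM_greatest[OF assms(3)]
    by (simp add: in_keys_iff)
  fix m assume m: "m \<in> Poly_Mapping.keys (ext_poly d a b)"
    "m \<noteq> LM a + Poly_Mapping.single (Y (Suc d)) 1"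
  obtain n s where n: "n \<in> ml_monoms d" "m = n + Poly_Mapping.single (step_var s (Suc d)) 1"
    "n \<in> Poly_Mapping.keys (case s of XStep \<Rightarrow> b | YStep \<Rightarrow> a)"
    using ext_poly_keysE[OF assms(1,2) m(1)] by blast
  show "grevlex_less m (LM a + Poly_Mapping.single (Y (Suc d)) 1)"
  proof (cases s)
    case XStep
    then show ?thesis using grevlex_less_last_step[OF n(1) LMa] n(2) by simp
  next
    case YStep
    then show ?thesis
      using n m(2) LM_greatest[OF assms(3)] grevlex_less_add_right by auto
  qed
qed

lemma LM_ext_poly_X:
  assumes "b \<in> ml_polys d" "b \<noteq> 0"
  shows "LM (ext_poly d 0 b) = LM b + Poly_Mapping.single (X (Suc d)) 1"
proof (rule LM_eqI)
  show "LM b + Poly_Mapping.single (X (Suc d)) 1 \<in> Poly_Mapping.keys (ext_poly d 0 b)"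
    using lookup_ext_poly[OF LM_in_ml_monoms[OF assms], of 0 b XStep] LM_greatest[OF assms(2)]
    by (simp add: in_keys_iff)
  fix m assume m: "m \<in> Poly_Mapping.keys (ext_poly d 0 b)"
    "m \<noteq> LM b + Poly_Mapping.single (X (Suc d)) 1"
  obtain n s where n: "n \<in> ml_monoms d" "m = n + Poly_Mapping.single (step_var s (Suc d)) 1"
    "n \<in> Poly_Mapping.keys (case s of XStep \<Rightarrow> b | YStep \<Rightarrow> 0)"
    using ext_poly_keysE[OF ml_polys_0 assms(1) m(1)] by blast
  then show "grevlex_less m (LM b + Poly_Mapping.single (X (Suc d)) 1)"
    using m(2) LM_greatest[OF assms(2)] grevlex_less_add_right by (cases s) auto
qed


section \<open>Powers of \<sigma> - 1 on pairs, and its nilpotency\<close>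

section \<open>The operator \<open>\<sigma> - 1\<close>\<close>

definition delta :: "'a::field mpoly \<Rightarrow> 'a mpoly" where
  "delta f = sigma f - f"

lemma sigma_eq_delta: "sigma f = f + delta f"
  by (simp add: delta_def)

lemma sigma_diff: "sigma (f - g) = sigma f - sigma g"
  by (metis sigma_add diff_add_cancel add_diff_cancel_right')

lemma delta_0 [simp]: "delta 0 = 0"
  by (simp add: delta_def)

lemma delta_add: "delta (f + g) = delta f + delta g"
  by (simp add: delta_def sigma_add)

lemma delta_diff: "delta (f - g) = delta f - delta g"
  by (simp add: delta_def sigma_diff)

lemma delta_const_mult: "delta (const c * f) = const c * delta f"
  by (simp add: delta_def sigma_mult algebra_simps)

lemma delta_pow_0 [simp]: "(delta ^^ j) 0 = 0"
  by (induction j) simp_all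

lemma delta_pow_add: "(delta ^^ j) (f + g) = (delta ^^ j) f + (delta ^^ j) g"
  by (induction j) (simp_all add: delta_add)

lemma delta_pow_diff: "(delta ^^ j) (f - g) = (delta ^^ j) f - (delta ^^ j) g"
  by (induction j) (simp_all add: delta_diff)

lemma delta_pow_const_mult: "(delta ^^ j) (const c * f) = const c * (delta ^^ j) f"
  by (induction j) (simp_all add: delta_const_mult)

lemma delta_pow_of_nat_mult: "(delta ^^ j) (of_nat n * f) = of_nat n * (delta ^^ j) f"
  by (simp only: of_nat_eq_const delta_pow_const_mult)

lemma delta_pow_sigma: "(delta ^^ j) (sigma f) = (delta ^^ j) f + (delta ^^ Suc j) f"
  unfolding sigma_eq_delta delta_pow_add by (simp add: funpow_swap1)

lemma sigma_ext_poly: "sigma (ext_poly d a b) = ext_poly d (sigma a) (sigma a + sigma b)"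
  by (simp add: ext_poly_def sigma_add sigma_mult algebra_simps)

lemma delta_ext_poly: "delta (ext_poly d a b) = ext_poly d (delta a) (sigma a + delta b)"
  by (simp add: delta_def sigma_ext_poly ext_poly_diff add_diff_eq)

text \<open>A Leibniz rule: \<sigma> - 1 is a twisted derivation sending y to x and x to 0, so y is
  hit at most once, in one of j places. At j = 0 the truncated j - 1 is harmless, being multiplied
  by 0.\<close>

lemma delta_pow_ext_poly:
  "(delta ^^ j) (ext_poly d a b) =
     ext_poly d ((delta ^^ j) a) (of_nat j * (delta ^^ (j - 1)) (sigma a) + (delta ^^ j) b)"
proof (induction j)
  case (Suc j)
  have "delta (of_nat j * (delta ^^ (j - 1)) (sigma a)) = of_nat j * (delta ^^ j) (sigma a)"
    using delta_pow_of_nat_mult[of 1 j] by (cases j) simp_all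
  moreover have "sigma ((delta ^^ j) a) = (delta ^^ j) (sigma a)"
    by (simp add: delta_pow_sigma sigma_eq_delta[of "(delta ^^ j) a"])
  ultimately show ?case
    by (simp add: Suc.IH delta_ext_poly delta_add algebra_simps)
qed simp

lemma ml_polys_eq_const: "f \<in> ml_polys 0 \<Longrightarrow> \<exists>c. f = const c"
  unfolding ml_polys_def ml_monoms_0 const_def
  by (rule exI[of _ "Poly_Mapping.lookup f 0"], rule poly_mapping_eqI)
    (auto simp: lookup_single when_def in_keys_iff)

lemma ml_polys_sigma: "f \<in> ml_polys d \<Longrightarrow> sigma f \<in> ml_polys d"
proof (induction d arbitrary: f)
  case 0
  then obtain c where "f = const c" using ml_polys_eq_const by blast
  with 0 show ?case by simp
next
  case (Suc d)
  obtain a b where "a \<in> ml_polys d" "b \<in> ml_polys d" "f = ext_poly d a b"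
    using ml_polys_SucE[OF Suc.prems] by blast
  then show ?case
    by (simp add: sigma_ext_poly ext_poly_in_ml_polys ml_polys_add Suc.IH)
qed

lemma ml_polys_delta: "f \<in> ml_polys d \<Longrightarrow> delta f \<in> ml_polys d"
  by (simp add: delta_def ml_polys_diff ml_polys_sigma)

lemma ml_polys_delta_pow: "f \<in> ml_polys d \<Longrightarrow> (delta ^^ j) f \<in> ml_polys d"
  by (induction j) (simp_all add: ml_polys_delta)

text \<open>In characteristic p this reflects (\<sigma> - 1)^p = \<sigma>^p - 1. In the induction
  the mixed term of \<open>delta_pow_ext_poly\<close> carries the factor p = 0, so the power acts on
  the two parts separately.\<close>

lemma delta_pow_CHAR_eq_0:
  fixes f :: "'a::field mpoly"
  assumes "0 < CHAR('a)" "f \<in> ml_polys d"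
  shows "(delta ^^ CHAR('a)) f = 0"
  using assms(2)
proof (induction d arbitrary: f)
  case 0
  then obtain c where "f = const c" using ml_polys_eq_const by blast
  then have "delta f = 0" by (simp add: delta_def)
  then show ?case using assms(1) by (cases "CHAR('a)") (simp_all add: funpow_swap1)
next
  case (Suc d)
  then obtain a b where ab: "a \<in> ml_polys d" "b \<in> ml_polys d" "f = ext_poly d a b"
    using ml_polys_SucE by blast
  have "(of_nat CHAR('a) :: 'a mpoly) = 0"
    by (simp add: of_nat_eq_const const_def)
  then show ?case
    using ab Suc.IH by (simp add: delta_pow_ext_poly)
qed

section \<open>The kernel of \<sigma> - 1 inside the images of its powers\<close>

text \<open>The K(d, j) of the overview. A nonzero element is the last vector of a Jordan chain g, D
  g, ..., D^j g of \<open>delta\<close>; for prime characteristic p these sets filter the socle of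
  the C_p-module by radical powers.\<close>

definition socle_layer :: "nat \<Rightarrow> nat \<Rightarrow> 'a::field mpoly set" where
  "socle_layer d j = {f \<in> ml_polys d. delta f = 0 \<and> (\<exists>g \<in> ml_polys d. f = (delta ^^ j) g)}"

lemma socle_layerI:
  "delta ((delta ^^ j) g) = 0 \<Longrightarrow> g \<in> ml_polys d \<Longrightarrow> (delta ^^ j) g \<in> socle_layer d j"
  by (auto simp: socle_layer_def ml_polys_delta_pow)

lemma socle_layer_subset: "socle_layer d j \<subseteq> ml_polys d"
  by (auto simp: socle_layer_def)

text \<open>Compares the two parts in f = D^j g and in D f = 0. The kernel condition on the y-part
  turns \<open>sigma a\<close> into a in the last equation.\<close>

lemma ext_poly_socle_layer:
  assumes "a \<in> ml_polys d" "b \<in> ml_polys d" "ext_poly d a b \<in> socle_layer (Suc d) j"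
  obtains a' b' where "a' \<in> ml_polys d" "b' \<in> ml_polys d" "a = (delta ^^ j) a'"
    "b = of_nat j * (delta ^^ (j - 1)) (sigma a') + (delta ^^ j) b'"
    "delta a = 0" "a + delta b = 0"
proof -
  obtain g where "g \<in> ml_polys (Suc d)" "ext_poly d a b = (delta ^^ j) g"
    using assms(3) by (auto simp: socle_layer_def)
  moreover from this(1) obtain a' b' where "a' \<in> ml_polys d" "b' \<in> ml_polys d"
    "g = ext_poly d a' b'"
    by (rule ml_polys_SucE)
  ultimately have ab': "a' \<in> ml_polys d" "b' \<in> ml_polys d"
    "ext_poly d a b = (delta ^^ j) (ext_poly d a' b')"
    by simp_all
  then have 1: "a = (delta ^^ j) a' \<and> b = of_nat j * (delta ^^ (j - 1)) (sigma a') + (delta ^^ j) b'"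
    using assms(1,2) unfolding delta_pow_ext_poly
    by (subst (asm) ext_poly_inject)
      (simp_all add: ml_polys_add ml_polys_of_nat_mult ml_polys_sigma ml_polys_delta_pow)
  have "ext_poly d (delta a) (sigma a + delta b) = 0"
    using assms(3) by (simp add: socle_layer_def delta_ext_poly)
  then have 2: "delta a = 0 \<and> sigma a + delta b = 0"
    using assms(1,2) by (subst (asm) ext_poly_eq_0_iff)
      (simp_all add: ml_polys_add ml_polys_sigma ml_polys_delta)
  show thesis
    using that[OF ab'(1,2)] 1 2 by (auto simp: sigma_eq_delta)
qed

text \<open>Such n is not divisible by the characteristic, so it is invertible in the field; the
  inverse acts as a constant polynomial.\<close>

lemma of_nat_CHAR_cancel:
  fixes f :: "'a::field mpoly"
  assumes "0 < n" "n < CHAR('a)"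
  shows "const (inverse (of_nat n)) * (of_nat n * f) = f"
    and "of_nat n * (const (inverse (of_nat n)) * f) = f"
proof -
  have "(of_nat n :: 'a) \<noteq> 0"
    using assms by (auto simp: of_nat_eq_0_iff_char_dvd dest: dvd_imp_le)
  then have inv: "const (inverse (of_nat n)) * (of_nat n :: 'a mpoly) = 1"
    unfolding of_nat_eq_const const_def mult_single by simp
  then show "const (inverse (of_nat n)) * (of_nat n * f) = f"
    by (simp only: mult.assoc[symmetric] mult_1_left)
  from inv show "of_nat n * (const (inverse (of_nat n)) * f) = f"
    by (subst mult.left_commute) (simp only: mult.assoc[symmetric] mult_1_left)
qed

lemma ext_poly_0_in_socle_layer_iff:
  fixes b :: "'a::field mpoly"
  assumes b: "b \<in> ml_polys d" and j: "j < CHAR('a)"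
  shows "ext_poly d 0 b \<in> socle_layer (Suc d) j \<longleftrightarrow> b \<in> socle_layer d (j - 1)"
proof
  assume "ext_poly d 0 b \<in> socle_layer (Suc d) j"
  then obtain a' b' where ab': "a' \<in> ml_polys d" "b' \<in> ml_polys d"
    "b = of_nat j * (delta ^^ (j - 1)) (sigma a') + (delta ^^ j) b'" "0 + delta b = 0"
    by (rule ext_poly_socle_layer[OF ml_polys_0 b])
  show "b \<in> socle_layer d (j - 1)"
  proof (cases j)
    case 0
    then show ?thesis using ab' by (simp add: socle_layer_def)
  next
    case (Suc i)
    \<comment> \<open>One factor D^(j-1) can be pulled out of both summands.\<close>
    have "b = (delta ^^ i) (of_nat j * sigma a' + delta b')"
      using ab'(3) Suc by (simp add: delta_pow_add delta_pow_of_nat_mult funpow_swap1 del: of_nat_Suc)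
    moreover have "of_nat j * sigma a' + delta b' \<in> ml_polys d"
      using ab'(1,2) by (intro ml_polys_add ml_polys_of_nat_mult ml_polys_sigma ml_polys_delta)
    ultimately show ?thesis
      using Suc ab'(4) b unfolding socle_layer_def by auto
  qed
next
  assume asm: "b \<in> socle_layer d (j - 1)"
  then obtain c where c: "c \<in> ml_polys d" "b = (delta ^^ (j - 1)) c" "delta b = 0"
    by (auto simp: socle_layer_def)
  have "\<exists>g \<in> ml_polys (Suc d). ext_poly d 0 b = (delta ^^ j) g"
  proof (cases j)
    case 0
    then show ?thesis using b by (auto intro!: bexI[of _ "ext_poly d 0 b"] ext_poly_in_ml_polys)
  next
    case (Suc i)
    \<comment> \<open>The preimage a y has x-part j D^(j-1) (sigma a), so dividing c by j gives b +
      D b = b; its y-part is D b / j = 0.\<close>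
    define a where "a = const (inverse (of_nat j)) * c"
    have "(delta ^^ Suc i) c = 0" using c Suc by simp
    then have "(delta ^^ j) a = 0" "of_nat j * (delta ^^ (j - 1)) (sigma a) = b"
      using Suc j c(2) of_nat_CHAR_cancel(2)[of j b]
      by (simp_all add: a_def delta_pow_const_mult delta_pow_sigma
          del: funpow.simps of_nat_Suc)
    then show ?thesis
      using c(1) by (intro bexI[of _ "ext_poly d a 0"])
        (simp_all add: delta_pow_ext_poly a_def ext_poly_in_ml_polys ml_polys_const_mult)
  qed
  then show "ext_poly d 0 b \<in> socle_layer (Suc d) j"
    using c(3) b by (simp add: socle_layer_def delta_ext_poly ext_poly_in_ml_polys)
qed

text \<open>Only a matters for the lead monomial when a is nonzero, so b is quantified away. The cap
  at p - 1 reflects that j + 1 is invertible only for j < p - 1.\<close>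

lemma ex_ext_poly_in_socle_layer_iff:
  fixes a :: "'a::field mpoly"
  assumes a: "a \<in> ml_polys d" and j: "j < CHAR('a)"
  shows "(\<exists>b \<in> ml_polys d. ext_poly d a b \<in> socle_layer (Suc d) j) \<longleftrightarrow>
    a \<in> socle_layer d (min (Suc j) (CHAR('a) - 1))"
proof
  assume "\<exists>b \<in> ml_polys d. ext_poly d a b \<in> socle_layer (Suc d) j"
  then obtain b where "b \<in> ml_polys d" "ext_poly d a b \<in> socle_layer (Suc d) j"
    by blast
  then obtain a' b' where ab': "a' \<in> ml_polys d" "b' \<in> ml_polys d" "a = (delta ^^ j) a'"
    "b = of_nat j * (delta ^^ (j - 1)) (sigma a') + (delta ^^ j) b'" "delta a = 0" "a + delta b = 0"
    by (rule ext_poly_socle_layer[OF a])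
  show "a \<in> socle_layer d (min (Suc j) (CHAR('a) - 1))"
  proof (cases "Suc j < CHAR('a)")
    case True
    \<comment> \<open>For j = 0 the truncated exponent is wrong by one, but both sides are
      0.\<close>
    have "delta (of_nat j * (delta ^^ (j - 1)) (sigma a')) = of_nat j * (delta ^^ j) (sigma a')"
      using delta_pow_of_nat_mult[of 1 j] by (cases j) simp_all
    also have "\<dots> = of_nat j * a"
      using ab'(3,5) by (simp add: delta_pow_sigma)
    \<comment> \<open>Since D b = j a + D^(j+1) b', the equation a + D b = 0 puts (j + 1) a in the
      image of D^(j+1); division by j + 1 follows.\<close>
    finally have "of_nat (Suc j) * a + (delta ^^ Suc j) b' = 0"
      using ab'(6) by (simp add: ab'(4) delta_add algebra_simps)
    then have "of_nat (Suc j) * a = (delta ^^ Suc j) (0 - b')"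
      unfolding delta_pow_diff delta_pow_0 by (simp only: diff_0 add_eq_0_iff2)
    then have "a = (delta ^^ Suc j) (const (inverse (of_nat (Suc j))) * (0 - b'))"
      using of_nat_CHAR_cancel(1)[of "Suc j" a] True
      by (simp add: delta_pow_const_mult del: funpow.simps of_nat_Suc diff_0)
    moreover have "const (inverse (of_nat (Suc j))) * (0 - b') \<in> ml_polys d"
      using ab'(2) by (intro ml_polys_const_mult ml_polys_diff ml_polys_0)
    ultimately have "a \<in> socle_layer d (Suc j)"
      unfolding socle_layer_def using a ab'(5) by blast
    moreover have "min (Suc j) (CHAR('a) - 1) = Suc j" using True by simp
    ultimately show ?thesis by simp
  next
    case False
    then have "min (Suc j) (CHAR('a) - 1) = j" using j by simp
    then show ?thesis using a ab' by (auto simp: socle_layer_def)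
  qed
next
  assume asm: "a \<in> socle_layer d (min (Suc j) (CHAR('a) - 1))"
  show "\<exists>b \<in> ml_polys d. ext_poly d a b \<in> socle_layer (Suc d) j"
  proof (cases "Suc j < CHAR('a)")
    case True
    with asm obtain c where c: "c \<in> ml_polys d" "a = (delta ^^ Suc j) c" "delta a = 0"
      by (auto simp: socle_layer_def min_def split: if_splits)
    \<comment> \<open>The preimage is (D c) y + b' x. Its y-part maps to a, and b' is chosen so that
      a + D b = a + j a - (j + 1) a = 0.\<close>
    define b' where "b' = 0 - of_nat (Suc j) * c"
    define b where "b = of_nat j * (delta ^^ (j - 1)) (sigma (delta c)) + (delta ^^ j) b'"
    have b: "b' \<in> ml_polys d" "b \<in> ml_polys d"
      unfolding b_def b'_def using c(1)
      by (intro ml_polys_add ml_polys_of_nat_mult ml_polys_sigma ml_polys_delta ml_polys_delta_pow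
          ml_polys_diff ml_polys_0; assumption)+
    have eq: "ext_poly d a b = (delta ^^ j) (ext_poly d (delta c) b')"
      unfolding delta_pow_ext_poly b_def c(2) by (simp add: funpow_swap1)
    have "delta (of_nat j * (delta ^^ (j - 1)) (sigma (delta c))) =
        of_nat j * (delta ^^ j) (sigma (delta c))"
      using delta_pow_of_nat_mult[of 1 j] by (cases j) simp_all
    also have "\<dots> = of_nat j * a"
      using c(2,3) by (simp add: delta_pow_sigma funpow_swap1)
    finally have "delta b = of_nat j * a + (delta ^^ Suc j) b'"
      by (simp add: b_def delta_add)
    also have "(delta ^^ Suc j) b' = 0 - of_nat (Suc j) * a"
      unfolding b'_def delta_pow_diff delta_pow_of_nat_mult c(2) by simp
    finally have "a + delta b = 0" by (simp add: algebra_simps)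
    then have "delta (ext_poly d a b) = 0"
      using c(3) by (simp add: delta_ext_poly sigma_eq_delta)
    moreover have "ext_poly d (delta c) b' \<in> ml_polys (Suc d)"
      using b(1) c(1) by (intro ext_poly_in_ml_polys ml_polys_delta)
    ultimately have "ext_poly d a b \<in> socle_layer (Suc d) j"
      unfolding eq by (rule socle_layerI)
    with b(2) show ?thesis by blast
  next
    case False
    \<comment> \<open>Here j = p - 1, and any preimage serves: D^p = 0 puts D^j (c y) in the
      kernel.\<close>
    then have j_eq: "CHAR('a) = Suc j" using j by simp
    with asm obtain c where c: "c \<in> ml_polys d" "a = (delta ^^ j) c"
      by (auto simp: socle_layer_def)
    define b where "b = of_nat j * (delta ^^ (j - 1)) (sigma c)"
    have b: "b \<in> ml_polys d"
      unfolding b_def using c(1) by (intro ml_polys_of_nat_mult ml_polys_delta_pow ml_polys_sigma)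
    have eq: "ext_poly d a b = (delta ^^ j) (ext_poly d c 0)"
      by (simp add: delta_pow_ext_poly b_def c(2))
    have ext: "ext_poly d c 0 \<in> ml_polys (Suc d)"
      using c(1) by (simp add: ext_poly_in_ml_polys)
    have "delta ((delta ^^ j) (ext_poly d c 0)) = 0"
      using delta_pow_CHAR_eq_0[OF _ ext] j_eq by simp
    with ext have "ext_poly d a b \<in> socle_layer (Suc d) j"
      unfolding eq by (rule socle_layerI[rotated])
    with b show ?thesis by blast
  qed
qed

section \<open>Lead monomials of the layers, matched with paths\<close>

section \<open>Lead monomials\<close>

definition lead_monoms :: "'a::zero mpoly set \<Rightarrow> monom set" where
  "lead_monoms S = LM ` (S - {0})"

text \<open>Split on whether the y-part vanishes: if it does, the x-part ranges over K(d, j - 1); if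
  not, the lead monomial depends only on the y-part, and the completing x-part is arbitrary.\<close>

lemma lead_monoms_socle_layer_Suc:
  assumes j: "j < CHAR('a::field)"
  shows "lead_monoms (socle_layer (Suc d) j :: 'a mpoly set) =
    (\<lambda>m. m + Poly_Mapping.single (X (Suc d)) 1) `
      lead_monoms (socle_layer d (j - 1) :: 'a mpoly set) \<union>
    (\<lambda>m. m + Poly_Mapping.single (Y (Suc d)) 1) `
      lead_monoms (socle_layer d (min (Suc j) (CHAR('a) - 1)) :: 'a mpoly set)"
  (is "?L = ?A \<union> ?B")
proof
  show "?L \<subseteq> ?A \<union> ?B"
  proof
    fix m assume "m \<in> ?L"
    then obtain f :: "'a mpoly" where f: "f \<in> socle_layer (Suc d) j" "f \<noteq> 0" "m = LM f"
      by (auto simp: lead_monoms_def)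
    obtain a b where ab: "a \<in> ml_polys d" "b \<in> ml_polys d" "f = ext_poly d a b"
      by (rule ml_polys_SucE[OF subsetD[OF socle_layer_subset f(1)]])
    show "m \<in> ?A \<union> ?B"
    proof (cases "a = 0")
      case True
      then have "b \<in> socle_layer d (j - 1)" "b \<noteq> 0"
        using f ab ext_poly_0_in_socle_layer_iff[OF ab(2) j] by auto
      then show ?thesis
        unfolding f(3) ab(3) True LM_ext_poly_X[OF ab(2) \<open>b \<noteq> 0\<close>] lead_monoms_def by blast
    next
      case False
      then have "a \<in> socle_layer d (min (Suc j) (CHAR('a) - 1))"
        using f ab ex_ext_poly_in_socle_layer_iff[OF ab(1) j] by blast
      then show ?thesis
        using False unfolding f(3) ab(3) LM_ext_poly_Y[OF ab(1,2) False] lead_monoms_def by blast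
    qed
  qed
  have "?A \<subseteq> ?L"
  proof
    fix m assume "m \<in> ?A"
    then obtain b :: "'a mpoly" where b: "b \<in> socle_layer d (j - 1)" "b \<noteq> 0"
      "m = LM b + Poly_Mapping.single (X (Suc d)) 1"
      by (auto simp: lead_monoms_def)
    have b_ml: "b \<in> ml_polys d" using b(1) socle_layer_subset by blast
    then have "ext_poly d 0 b \<in> socle_layer (Suc d) j - {0}"
      using b ext_poly_0_in_socle_layer_iff[OF b_ml j] ext_poly_eq_0_iff[of 0 d b] by simp
    then show "m \<in> ?L"
      unfolding b(3) LM_ext_poly_X[OF b_ml b(2), symmetric] lead_monoms_def by (rule imageI)
  qed
  moreover have "?B \<subseteq> ?L"
  proof
    fix m assume "m \<in> ?B"
    then obtain a :: "'a mpoly" where a: "a \<in> socle_layer d (min (Suc j) (CHAR('a) - 1))" "a \<noteq> 0"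
      "m = LM a + Poly_Mapping.single (Y (Suc d)) 1"
      by (auto simp: lead_monoms_def)
    have a_ml: "a \<in> ml_polys d" using a(1) socle_layer_subset by blast
    then obtain b where b: "b \<in> ml_polys d" "ext_poly d a b \<in> socle_layer (Suc d) j"
      using a(1) ex_ext_poly_in_socle_layer_iff[OF a_ml j] by blast
    then have "ext_poly d a b \<in> socle_layer (Suc d) j - {0}"
      using a(2) ext_poly_eq_0_iff[OF a_ml b(1)] by simp
    then show "m \<in> ?L"
      unfolding a(3) LM_ext_poly_Y[OF a_ml b(1) a(2), symmetric] lead_monoms_def by (rule imageI)
  qed
  ultimately show "?A \<union> ?B \<subseteq> ?L" by simp
qed

text \<open>Without variables only constants remain and \<open>delta\<close> is 0, so every layer
  with j > 0 is trivial, in agreement with \<open>good_path_Nil\<close>.\<close>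

lemma lead_monoms_socle_layer_0:
  "lead_monoms (socle_layer 0 j :: 'a::field mpoly set) = (if j = 0 then {0} else {})"
proof (cases j)
  case 0
  have "1 \<in> socle_layer 0 0 - {0 :: 'a mpoly}"
    using sigma_const[of "1::'a"]
    by (auto simp: socle_layer_def ml_polys_def ml_monoms_0 delta_def const_def)
  moreover have "LM f = 0" if "f \<in> socle_layer 0 0 - {0 :: 'a mpoly}" for f
    using that LM_in_ml_monoms[of f 0] socle_layer_subset[of 0 0] by (auto simp: ml_monoms_0)
  ultimately show ?thesis
    unfolding lead_monoms_def using 0 by force
next
  case (Suc i)
  have "delta g = 0" if "g \<in> ml_polys 0" for g :: "'a mpoly"
    using ml_polys_eq_const[OF that] by (auto simp: delta_def)
  then have "f = 0" if "f \<in> socle_layer 0 j" for f :: "'a mpoly"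
    using that Suc by (auto simp: socle_layer_def funpow_swap1)
  then show ?thesis using Suc by (auto simp: lead_monoms_def)
qed

text \<open>Both sides satisfy the same recursion in d, with q = p - 1 as the cap. It moves j down
  and up, so j stays general in the induction; 1 < p makes q positive, as the empty path
  requires.\<close>

lemma lead_monoms_socle_layer:
  assumes "j < CHAR('a::field)" "1 < CHAR('a)"
  shows "lead_monoms (socle_layer d j :: 'a mpoly set) =
    Lam ` {\<gamma>. length \<gamma> = d \<and> good_path (CHAR('a) - 1) j \<gamma>}"
  using assms(1)
proof (induction d arbitrary: j)
  case 0
  have "{\<gamma>. length \<gamma> = 0 \<and> good_path (CHAR('a) - 1) j \<gamma>} = (if j = 0 then {[]} else {})"
    using assms(2) by (auto simp: good_path_Nil)
  then show ?case by (simp add: lead_monoms_socle_layer_0)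
next
  case (Suc d)
  have "j - 1 < CHAR('a)" "min (Suc j) (CHAR('a) - 1) < CHAR('a)" "j \<le> CHAR('a) - 1"
    using Suc.prems assms(2) by auto
  then show ?case
    unfolding lead_monoms_socle_layer_Suc[OF Suc.prems] good_path_Suc_eq[OF \<open>j \<le> CHAR('a) - 1\<close>]
    by (simp add: Suc.IH image_Un image_image Lam_snoc cong: image_cong_simp)
qed

section \<open>Invariants as the layer j = 0, and the bijection\<close>

lemma multilinear_invariants_eq: "multilinear_invariants d = socle_layer d 0"
proof -
  have "f \<in> invariants \<longleftrightarrow> delta f = 0" for f :: "'a mpoly"
  proof
    assume "f \<in> invariants"
    then have "(sigma ^^ 1) f = f" unfolding invariants_def by blast
    then show "delta f = 0" by (simp add: delta_def)
  next
    assume "delta f = 0"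
    then have "(sigma ^^ k) f = f" for k
      by (induction k) (simp_all add: delta_def)
    then show "f \<in> invariants" by (simp add: invariants_def)
  qed
  then show ?thesis
    unfolding multilinear_invariants_def homogeneous_component_eq_ml_polys socle_layer_def by auto
qed

theorem mainTheorem3:
  fixes p d :: nat and M :: "monom set"
  assumes "prime p"
    and "CHAR('a::field) = p"
    and "M = {LM f | f :: 'a mpoly. f \<noteq> 0 \<and> f \<in> multilinear_invariants d}"
  shows "PDP_le d (int p - 2) \<inter> IDP d (int p - 1) = {} \<and>
    bij_betw Lam (PDP_le d (int p - 2) \<union> IDP d (int p - 1)) M"
proof
  have p: "1 < p" using assms(1) by (rule prime_gt_1_nat)
  \<comment> \<open>With q = p - 1 as a natural number, height at most p - 2 is
    \<open>bounded_dyck q\<close> and the escape height is q.\<close>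
  then have q: "int p - 2 = int (p - 1) - 1" "int p - 1 = int (p - 1)" by auto
  show "PDP_le d (int p - 2) \<inter> IDP d (int p - 1) = {}"
    unfolding q PDP_le_eq IDP_def using bounded_not_initial_dyck by auto
  \<comment> \<open>At j = 0 the condition on the final elevation already follows from
    boundedness.\<close>
  have paths: "PDP_le d (int p - 2) \<union> IDP d (int p - 1) =
      {\<gamma>. length \<gamma> = d \<and> good_path (p - 1) 0 \<gamma>}"
    unfolding q PDP_le_eq IDP_def good_path_0 by auto
  have "M = lead_monoms (socle_layer d 0 :: 'a mpoly set)"
    unfolding assms(3) multilinear_invariants_eq lead_monoms_def by auto
  also have "\<dots> = Lam ` {\<gamma>. length \<gamma> = d \<and> good_path (p - 1) 0 \<gamma>}"
    using lead_monoms_socle_layer[of 0 d, where 'a='a] p assms(2) by simp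
  finally show "bij_betw Lam (PDP_le d (int p - 2) \<union> IDP d (int p - 1)) M"
    unfolding paths bij_betw_def using inj_on_Lam by (auto intro: inj_on_subset)
qed

end
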